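(* For every integer $n\geq 0$ and every integer $s\geq 0$, the coefficient of $q^s$ in the polynomial $\phi_n(q)$ equals $rac(n,s)$.
   Context: A composition of $n$ of length $s$ is a sequence $\sigma=(\sigma_1,\ldots,\sigma_s)$ of positive integers with $\sum_i\sigma_i=n$; the empty composition is the unique composition of $0$, of length $0$. A composition is anti-palindromic if $\sigma_i\neq\sigma_{s-i+1}$ for all $i$ with $i\neq\frac{s+1}{2}$ (the empty composition is vacuously anti-palindromic). Two anti-palindromic compositions of $n$ of length $s$ are flip-equivalent if one is obtained from the other by swapping the entries $\sigma_i$ and $\sigma_{s-i+1}$ for some set of indices $i\neq\frac{s+1}{2}$; each equivalence class (a reduced anti-palindromic composition) has $2^{\lfloor s/2\rfloor}$ elements. $rac(n,s)$ is the number of flip-equivalence classes of anti-palindromic compositions of $n$ of length $s$, i.e. $rac(n,s)=ac(n,s)/2^{\lfloor s/2\rfloor}$ where $ac(n,s)$ is the number of anti-palindromic compositions of $n$ of length $s$. The polynomials $\phi_n(q)$ are defined by $\phi_0(q)=1$, $\phi_1(q)=q$, $\phi_2(q)=q$, $\phi_3(q)=q+q^2$, and $\phi_n(q)=\phi_{n-1}(q)+\phi_{n-2}(q)+(q^2-1)\phi_{n-3}(q)$ for $n>3$. *)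

theory Defs
  imports "HOL-Computational_Algebra.Polynomial"
begin

definition compositions :: "nat \<Rightarrow> nat \<Rightarrow> nat list set" where
  "compositions n s = {xs. length xs = s \<and> (\<forall>x\<in>set xs. 0 < x) \<and> sum_list xs = n}"

text \<open>
  Lists are indexed from 0, so the mirror image of position \<open>i\<close> in a list of length \<open>s\<close> is
  \<open>s - 1 - i\<close>, and the middle position (present only for odd \<open>s\<close>) is the one with
  \<open>2 * i + 1 = s\<close>.
\<close>

definition anti_palindromic :: "'a list \<Rightarrow> bool" where
  "anti_palindromic xs \<longleftrightarrow>
    (\<forall>i<length xs. 2 * i + 1 \<noteq> length xs \<longrightarrow> xs ! i \<noteq> xs ! (length xs - 1 - i))"

definition ap_compositions :: "nat \<Rightarrow> nat \<Rightarrow> nat list set" where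
  "ap_compositions n s = {xs \<in> compositions n s. anti_palindromic xs}"

text \<open>
  Swapping the entries at \<open>i\<close> and its mirror image, for all \<open>i \<in> I\<close>. Each mirror pair meeting
  \<open>I\<close> is swapped once, even if \<open>I\<close> contains both of its positions.
\<close>

definition flip_entries :: "nat set \<Rightarrow> 'a list \<Rightarrow> 'a list" where
  "flip_entries I xs =
    map (\<lambda>j. if j \<in> I \<or> length xs - 1 - j \<in> I then xs ! (length xs - 1 - j) else xs ! j)
      [0..<length xs]"

definition flip_equiv :: "nat \<Rightarrow> nat \<Rightarrow> (nat list \<times> nat list) set" where
  "flip_equiv n s =
    {(xs, ys). xs \<in> ap_compositions n s \<and> ys \<in> ap_compositions n s \<and>
      (\<exists>I \<subseteq> {i. i < s \<and> 2 * i + 1 \<noteq> s}. ys = flip_entries I xs)}"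

definition rac :: "nat \<Rightarrow> nat \<Rightarrow> nat" where
  "rac n s = card (ap_compositions n s // flip_equiv n s)"

fun phi :: "nat \<Rightarrow> int poly" where
  "phi 0 = 1"
| "phi (Suc 0) = [:0, 1:]"
| "phi (Suc (Suc 0)) = [:0, 1:]"
| "phi (Suc (Suc (Suc 0))) = [:0, 1:] + [:0, 1:]\<^sup>2"
| "phi (Suc (Suc (Suc (Suc n)))) =
    phi (Suc (Suc (Suc n))) + phi (Suc (Suc n)) + ([:0, 1:]\<^sup>2 - 1) * phi (Suc n)"

lemma length_flip_entries [simp]: "length (flip_entries I xs) = length xs"
  by (simp add: flip_entries_def)

lemma nth_flip_entries:
  "j < length xs \<Longrightarrow> flip_entries I xs ! j =
    (if j \<in> I \<or> length xs - 1 - j \<in> I then xs ! (length xs - 1 - j) else xs ! j)"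
  by (simp add: flip_entries_def)

lemma flip_entries_empty: "flip_entries {} xs = xs"
  by (simp add: list_eq_iff_nth_eq nth_flip_entries)

lemma flip_entries_flip_entries: "flip_entries I (flip_entries I xs) = xs"
proof (rule nth_equalityI)
  fix j assume "j < length (flip_entries I (flip_entries I xs))"
  then have j: "j < length xs" by simp
  then have "length xs - 1 - j < length xs" "length xs - 1 - (length xs - 1 - j) = j" by auto
  with j show "flip_entries I (flip_entries I xs) ! j = xs ! j"
    by (simp only: nth_flip_entries length_flip_entries) auto
qed simp

lemma flip_entries_comp:
  assumes "I \<subseteq> {i. i < length xs \<and> 2 * i + 1 \<noteq> length xs}"
    and "J \<subseteq> {i. i < length xs \<and> 2 * i + 1 \<noteq> length xs}"
  shows "\<exists>K \<subseteq> {i. i < length xs \<and> 2 * i + 1 \<noteq> length xs}.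
    flip_entries J (flip_entries I xs) = flip_entries K xs"
proof -
  let ?s = "length xs"
  define K where "K = {i. i < ?s \<and> 2 * i + 1 \<noteq> ?s \<and>
    ((i \<in> I \<or> ?s - 1 - i \<in> I) \<noteq> (i \<in> J \<or> ?s - 1 - i \<in> J))}"
  have "flip_entries J (flip_entries I xs) ! j = flip_entries K xs ! j" if "j < ?s" for j
  proof (cases "2 * j + 1 = ?s")
    case True
    then have "?s - 1 - j = j" by simp
    then show ?thesis using that by (simp add: nth_flip_entries)
  next
    case False
    have m: "?s - 1 - j < ?s" "?s - 1 - (?s - 1 - j) = j" "2 * (?s - 1 - j) + 1 \<noteq> ?s"
      using that False by auto
    have key: "(j \<in> K \<or> ?s - 1 - j \<in> K) \<longleftrightarrow>
        ((j \<in> I \<or> ?s - 1 - j \<in> I) \<noteq> (j \<in> J \<or> ?s - 1 - j \<in> J))"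
      unfolding K_def mem_Collect_eq m(2) using that False m by blast
    have flip: "flip_entries L ys ! i =
        (if i \<in> L \<or> ?s - 1 - i \<in> L then ys ! (?s - 1 - i) else ys ! i)"
      if "length ys = ?s" "i < ?s" for L i and ys :: "'a list"
      using nth_flip_entries[of i ys L] that by (simp only:)
    show ?thesis
      using key
      by (simp only: flip[OF length_flip_entries that] flip[OF length_flip_entries m(1)]
          flip[OF refl that] flip[OF refl m(1)] m(2))
        (cases "j \<in> I \<or> ?s - 1 - j \<in> I"; cases "j \<in> J \<or> ?s - 1 - j \<in> J"; simp only: if_True if_False disj_commute simp_thms)
  qed
  then have "flip_entries J (flip_entries I xs) = flip_entries K xs"
    by (simp add: list_eq_iff_nth_eq)
  moreover have "K \<subseteq> {i. i < ?s \<and> 2 * i + 1 \<noteq> ?s}"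
    by (auto simp: K_def)
  ultimately show ?thesis by blast
qed

lemma equiv_flip_equiv: "equiv (ap_compositions n s) (flip_equiv n s)"
proof (rule equivI)
  show "flip_equiv n s \<subseteq> ap_compositions n s \<times> ap_compositions n s"
    unfolding flip_equiv_def by blast
  show "refl_on (ap_compositions n s) (flip_equiv n s)"
  proof (rule refl_onI)
    fix xs assume "xs \<in> ap_compositions n s"
    moreover have "\<exists>I \<subseteq> {i. i < s \<and> 2 * i + 1 \<noteq> s}. xs = flip_entries I xs"
      by (rule exI[of _ "{}"]) (simp add: flip_entries_empty)
    ultimately show "(xs, xs) \<in> flip_equiv n s"
      unfolding flip_equiv_def by blast
  qed
  show "sym (flip_equiv n s)"
  proof (rule symI)
    fix xs ys assume a: "(xs, ys) \<in> flip_equiv n s"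
    then obtain I where I: "I \<subseteq> {i. i < s \<and> 2 * i + 1 \<noteq> s}" "ys = flip_entries I xs"
      unfolding flip_equiv_def by blast
    then have "xs = flip_entries I ys" by (simp only: flip_entries_flip_entries)
    with a I(1) show "(ys, xs) \<in> flip_equiv n s"
      unfolding flip_equiv_def by blast
  qed
  show "trans (flip_equiv n s)"
  proof (rule transI)
    fix xs ys zs
    assume a: "(xs, ys) \<in> flip_equiv n s" and b: "(ys, zs) \<in> flip_equiv n s"
    then have len: "length xs = s"
      by (simp add: flip_equiv_def ap_compositions_def compositions_def)
    from a obtain I where I: "I \<subseteq> {i. i < s \<and> 2 * i + 1 \<noteq> s}" "ys = flip_entries I xs"
      unfolding flip_equiv_def by blast
    from b obtain J where J: "J \<subseteq> {i. i < s \<and> 2 * i + 1 \<noteq> s}" "zs = flip_entries J ys"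
      unfolding flip_equiv_def by blast
    have "\<exists>K \<subseteq> {i. i < s \<and> 2 * i + 1 \<noteq> s}. zs = flip_entries K xs"
      using flip_entries_comp[of I xs J] I J unfolding len by blast
    then show "(xs, zs) \<in> flip_equiv n s"
      using a b unfolding flip_equiv_def mem_Collect_eq case_prod_conv by (intro conjI) simp_all
  qed
qed

end

theory Submission
  imports Defs
begin

text \<open>
  Every flip class contains exactly one composition in which the left entry of each mirror pair is
  the smaller one, so \<open>rac n s\<close> counts these. Removing the outer pair \<open>a < b\<close> of such a composition
  shows that the generating function of \<open>rac _ (s + 2)\<close> is that of \<open>rac _ s\<close> times
  \<open>x\<^sup>3 / ((1 - x) * (1 - x\<^sup>2))\<close>. Since \<open>(1 - x) * (1 - x\<^sup>2) = 1 - x - x\<^sup>2 + x\<^sup>3\<close>, this is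
  the recurrence of the polynomials \<open>phi n\<close>, read off coefficientwise.
\<close>

section \<open>Adjoining a strictly increasing pair of positive integers\<close>

text \<open>The weight \<open>w\<close> grades \<open>A\<close>, so that the inner compositions of
  every sum can be handled as one possibly infinite set whose fibres are finite.\<close>

definition pair_extensions :: "('a \<Rightarrow> nat) \<Rightarrow> 'a set \<Rightarrow> nat \<Rightarrow> (nat \<times> nat \<times> 'a) set" where
  "pair_extensions w A n = {(a, b, y). 0 < a \<and> a < b \<and> y \<in> A \<and> a + b + w y = n}"

lemma finite_pair_extensions:
  assumes "\<And>k. finite {y \<in> A. w y = k}"
  shows "finite (pair_extensions w A n)"
proof (rule finite_subset)
  show "pair_extensions w A n \<subseteq> {..n} \<times> {..n} \<times> (\<Union>k\<le>n. {y \<in> A. w y = k})"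
    by (auto simp: pair_extensions_def)
  show "finite ({..n} \<times> {..n} \<times> (\<Union>k\<le>n. {y \<in> A. w y = k}))"
    using assms by blast
qed

lemma pair_extensions_empty: "n < 3 \<Longrightarrow> pair_extensions w A n = {}"
  by (auto simp: pair_extensions_def)

text \<open>
  Lowering both entries of the pair by 1 leaves the triples with \<open>a = 1\<close>; among these, lowering
  \<open>b\<close> by 1 leaves the triples with \<open>(a, b) = (1, 2)\<close>.
\<close>

lemma card_pair_extensions:
  assumes fin: "\<And>k. finite {y \<in> A. w y = k}"
  shows "card (pair_extensions w A (n + 3)) + card (pair_extensions w A n) =
    card (pair_extensions w A (n + 2)) + card (pair_extensions w A (n + 1)) +
    card {y \<in> A. w y = n}"
proof -
  let ?T = "pair_extensions w A"
  define U where "U m = {t \<in> ?T m. fst t = 1}" for m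
  have finT: "finite (?T m)" for m
    using fin by (rule finite_pair_extensions)
  have finU: "finite (U m)" for m
    using finT by (simp add: U_def)
  have T: "card (?T (m + 2)) = card (U (m + 2)) + card (?T m)" for m
  proof -
    let ?f = "\<lambda>(a, b, y). (Suc a, Suc b, y)"
    have "?T (m + 2) = U (m + 2) \<union> ?f ` ?T m"
    proof (intro equalityI subsetI)
      fix t assume t: "t \<in> ?T (m + 2)"
      obtain a b y where aby: "t = (a, b, y)" by (cases t)
      show "t \<in> U (m + 2) \<union> ?f ` ?T m"
      proof (cases "a = 1")
        case True
        then show ?thesis using t by (simp add: U_def aby)
      next
        case False
        with t have "(a - 1, b - 1, y) \<in> ?T m" "t = ?f (a - 1, b - 1, y)"
          by (auto simp: pair_extensions_def aby)
        then show ?thesis by blast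
      qed
    qed (auto simp: pair_extensions_def U_def)
    moreover have "U (m + 2) \<inter> ?f ` ?T m = {}"
      by (auto simp: pair_extensions_def U_def)
    moreover have "card (?f ` ?T m) = card (?T m)"
      by (rule card_image) (auto simp: inj_on_def)
    ultimately show ?thesis
      using finT finU by (simp add: card_Un_disjoint)
  qed
  have U: "card (U (n + 3)) = card {y \<in> A. w y = n} + card (U (n + 2))"
  proof -
    let ?f = "\<lambda>(a, b, y). (a :: nat, Suc b, y)"
    let ?g = "\<lambda>y. (1 :: nat, 2 :: nat, y)"
    \<comment> \<open>The pair (1, 2) uses up 3 of the total and leaves weight \<open>n\<close> for
      \<open>y\<close>. If \<open>b\<close> is not 2, then \<open>b\<close> is at least 3 and
      \<open>b - 1\<close> still exceeds 1.\<close>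
    have "U (n + 3) = ?g ` {y \<in> A. w y = n} \<union> ?f ` U (n + 2)"
    proof (intro equalityI subsetI)
      fix t assume t: "t \<in> U (n + 3)"
      obtain a b y where aby: "t = (a, b, y)" by (cases t)
      show "t \<in> ?g ` {y \<in> A. w y = n} \<union> ?f ` U (n + 2)"
      proof (cases "b = 2")
        case True
        then show ?thesis using t by (auto simp: pair_extensions_def U_def aby)
      next
        case False
        with t have "(a, b - 1, y) \<in> U (n + 2)" "t = ?f (a, b - 1, y)"
          by (auto simp: pair_extensions_def U_def aby)
        then show ?thesis by blast
      qed
    qed (auto simp: pair_extensions_def U_def)
    moreover have "?g ` {y \<in> A. w y = n} \<inter> ?f ` U (n + 2) = {}"
      by (auto simp: pair_extensions_def U_def)
    moreover have "card (?f ` U (n + 2)) = card (U (n + 2))"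
      by (rule card_image) (auto simp: inj_on_def)
    moreover have "card (?g ` {y \<in> A. w y = n}) = card {y \<in> A. w y = n}"
      by (rule card_image) (auto simp: inj_on_def)
    ultimately show ?thesis
      using fin finU by (simp add: card_Un_disjoint)
  qed
  \<comment> \<open>The two instances of \<open>T\<close> involve \<open>U (n + 2)\<close> and
    \<open>U (n + 3)\<close>; fact \<open>U\<close> links these, so both cancel.\<close>
  show ?thesis
    using T[of n] T[of "n + 1"] U by (simp add: numeral_3_eq_3)
qed

section \<open>Canonical representatives of the flip classes\<close>

text \<open>The bound on \<open>i\<close> picks out the positions left of the middle, so each mirror
  pair is constrained once and a middle entry is free.\<close>

definition mirror_increasing :: "'a::linorder list \<Rightarrow> bool" where
  "mirror_increasing xs \<longleftrightarrow> (\<forall>i. 2 * i + 1 < length xs \<longrightarrow> xs ! i < xs ! (length xs - 1 - i))"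

lemma mirror_increasing_Cons_snoc:
  "mirror_increasing (a # ys @ [b]) \<longleftrightarrow> a < b \<and> mirror_increasing ys"
proof -
  \<comment> \<open>The outer list has length \<open>length ys + 2\<close>, so the mirror of
    \<open>Suc i\<close> is \<open>length ys - i\<close>, the shift by one of the inner mirror
    \<open>length ys - 1 - i\<close>.\<close>
  have inner: "(a # ys @ [b]) ! Suc i = ys ! i"
    "(a # ys @ [b]) ! (length ys - i) = ys ! (length ys - 1 - i)" if "2 * i + 1 < length ys" for i
  proof -
    have "length ys - i = Suc (length ys - 1 - i)" "length ys - 1 - i < length ys"
      using that by simp_all
    then show "(a # ys @ [b]) ! Suc i = ys ! i"
      "(a # ys @ [b]) ! (length ys - i) = ys ! (length ys - 1 - i)"
      using that by (simp_all add: nth_append)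
  qed
  have outer: "(a # ys @ [b]) ! Suc (length ys) = b"
    by (simp add: nth_append)
  show ?thesis
  proof
    assume *: "mirror_increasing (a # ys @ [b])"
    have "a < b"
      using * outer by (auto simp: mirror_increasing_def dest: spec[of _ 0])
    moreover have "ys ! i < ys ! (length ys - 1 - i)" if "2 * i + 1 < length ys" for i
      using *[unfolded mirror_increasing_def, rule_format, of "Suc i"] inner[OF that] that by simp
    ultimately show "a < b \<and> mirror_increasing ys"
      by (simp add: mirror_increasing_def)
  next
    assume *: "a < b \<and> mirror_increasing ys"
    have "(a # ys @ [b]) ! i < (a # ys @ [b]) ! (Suc (length ys) - i)" if "2 * i < Suc (length ys)" for i
    proof (cases i)
      case 0
      then show ?thesis using * outer by simp
    next
      case (Suc j)
      then have "2 * j + 1 < length ys" using that by simp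
      then show ?thesis
        using * inner[of j] by (simp add: Suc mirror_increasing_def)
    qed
    then show "mirror_increasing (a # ys @ [b])"
      by (simp add: mirror_increasing_def)
  qed
qed

definition mi_compositions :: "nat \<Rightarrow> nat \<Rightarrow> nat list set" where
  "mi_compositions n s = {xs \<in> compositions n s. mirror_increasing xs}"

lemma mi_compositions_subset: "mi_compositions n s \<subseteq> ap_compositions n s"
proof
  fix xs assume xs: "xs \<in> mi_compositions n s"
  have "xs ! i \<noteq> xs ! (length xs - 1 - i)" if "i < length xs" "2 * i + 1 \<noteq> length xs" for i
  proof (cases "2 * i + 1 < length xs")
    case True
    then show ?thesis using xs by (fastforce simp: mi_compositions_def mirror_increasing_def)
  next
    case False
    \<comment> \<open>Right of the middle, the strict inequality is applied at the mirror
      position.\<close>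
    then have "2 * (length xs - 1 - i) + 1 < length xs" "length xs - 1 - (length xs - 1 - i) = i"
      using that by auto
    then show ?thesis
      using xs unfolding mi_compositions_def mirror_increasing_def mem_Collect_eq
      by (metis less_irrefl)
  qed
  then show "xs \<in> ap_compositions n s"
    using xs by (simp add: mi_compositions_def ap_compositions_def anti_palindromic_def)
qed

lemma set_flip_entries_subset: "set (flip_entries I xs) \<subseteq> set xs"
  by (auto simp: flip_entries_def intro!: nth_mem)

text \<open>A flip reads the list through the involution \<open>p\<close> of its positions, so it
  only reorders the summands.\<close>

lemma sum_list_flip_entries:
  fixes xs :: "'a::comm_monoid_add list"
  shows "sum_list (flip_entries I xs) = sum_list xs"
proof -
  let ?s = "length xs"
  define p where "p j = (if j \<in> I \<or> ?s - 1 - j \<in> I then ?s - 1 - j else j)" for j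
  have p: "p j < ?s" "p (p j) = j" if "j < ?s" for j
    using that by (auto simp: p_def)
  have "sum_list (flip_entries I xs) = (\<Sum>j = 0..<?s. flip_entries I xs ! j)"
    by (simp add: sum_list_sum_nth)
  also have "\<dots> = (\<Sum>j = 0..<?s. xs ! p j)"
    by (intro sum.cong) (auto simp: nth_flip_entries p_def)
  also have "\<dots> = (\<Sum>j = 0..<?s. xs ! j)"
    by (rule sum.reindex_bij_witness[of _ p p]) (use p in auto)
  finally show ?thesis by (simp add: sum_list_sum_nth)
qed

lemma flip_entries_in_compositions:
  "xs \<in> compositions n s \<Longrightarrow> flip_entries I xs \<in> compositions n s"
  using set_flip_entries_subset[of I xs]
  by (auto simp: compositions_def sum_list_flip_entries)

text \<open>Swap exactly the pairs that stand in decreasing order; anti-palindromicity rules out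
  ties.\<close>

lemma ex_flip_mirror_increasing:
  assumes "xs \<in> ap_compositions n s"
  shows "\<exists>ys \<in> mi_compositions n s. (xs, ys) \<in> flip_equiv n s"
proof -
  have len: "length xs = s" and comp: "xs \<in> compositions n s" and "anti_palindromic xs"
    using assms by (auto simp: ap_compositions_def compositions_def)
  define I where "I = {i. 2 * i + 1 < s \<and> xs ! (s - 1 - i) < xs ! i}"
  have "flip_entries I xs ! i < flip_entries I xs ! (s - 1 - i)" if i: "2 * i + 1 < s" for i
  proof -
    \<comment> \<open>As \<open>I\<close> contains only positions left of the middle, whether a pair
      is swapped depends on its left position alone.\<close>
    have i': "i < s" "s - 1 - i < s" "s - 1 - (s - 1 - i) = i" "s - 1 - i \<notin> I"
      using i by (auto simp: I_def)
    have "xs ! i \<noteq> xs ! (s - 1 - i)"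
      using \<open>anti_palindromic xs\<close> i by (simp add: anti_palindromic_def len)
    moreover have "i \<in> I \<longleftrightarrow> xs ! (s - 1 - i) < xs ! i"
      using i by (simp add: I_def)
    ultimately show ?thesis
      using nth_flip_entries[of i xs I] nth_flip_entries[of "s - 1 - i" xs I] i'
      unfolding len i'(3) by auto
  qed
  then have mi: "flip_entries I xs \<in> mi_compositions n s"
    using flip_entries_in_compositions[OF comp]
    by (simp add: mi_compositions_def mirror_increasing_def len)
  have "I \<subseteq> {i. i < s \<and> 2 * i + 1 \<noteq> s}"
    by (auto simp: I_def)
  then have "(xs, flip_entries I xs) \<in> flip_equiv n s"
    using assms mi mi_compositions_subset unfolding flip_equiv_def by blast
  with mi show ?thesis by blast
qed

text \<open>Swapping a pair would reverse its strict order, so no pair can have been swapped; a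
  middle entry is its own mirror image.\<close>

lemma flip_equiv_mirror_increasing_eq:
  assumes "xs \<in> mi_compositions n s" "ys \<in> mi_compositions n s" "(xs, ys) \<in> flip_equiv n s"
  shows "xs = ys"
proof -
  obtain I where ys: "ys = flip_entries I xs"
    using assms(3) unfolding flip_equiv_def by blast
  have len: "length xs = s" "length ys = s"
    using assms by (auto simp: mi_compositions_def compositions_def)
  have incr: "zs ! i < zs ! (s - 1 - i)" if "zs \<in> {xs, ys}" "2 * i + 1 < s" for zs i
    using assms len that by (auto simp: mi_compositions_def mirror_increasing_def)
  have unswapped: "\<not> (i \<in> I \<or> s - 1 - i \<in> I)" if i: "2 * i + 1 < s" for i
  proof
    assume swap: "i \<in> I \<or> s - 1 - i \<in> I"
    have "i < s" "s - 1 - i < s" "s - 1 - (s - 1 - i) = i"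
      using i by auto
    then have "ys ! i = xs ! (s - 1 - i)" "ys ! (s - 1 - i) = xs ! i"
      using swap nth_flip_entries[of i xs I] nth_flip_entries[of "s - 1 - i" xs I]
      unfolding len ys by auto
    then show False
      using incr[of xs i] incr[of ys i] i by simp
  qed
  show ?thesis
  proof (rule nth_equalityI)
    fix i assume "i < length xs"
    then have i: "i < s" by (simp add: len)
    consider "2 * i + 1 < s" | "s - 1 - i = i"
      | "2 * (s - 1 - i) + 1 < s" "s - 1 - (s - 1 - i) = i"
      using i by linarith
    then show "xs ! i = ys ! i"
      using unswapped[of i] unswapped[of "s - 1 - i"] nth_flip_entries[of i xs I] i
      unfolding len ys by cases auto
  qed (simp add: len)
qed

text \<open>\<open>B\<close> is a transversal: it meets every class, and no class twice, so sending
  a representative to its class is a bijection.\<close>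

lemma card_quotient_representatives:
  assumes "equiv A r" "B \<subseteq> A"
    and "\<And>x. x \<in> A \<Longrightarrow> \<exists>y\<in>B. (x, y) \<in> r"
    and "\<And>x y. x \<in> B \<Longrightarrow> y \<in> B \<Longrightarrow> (x, y) \<in> r \<Longrightarrow> x = y"
  shows "card (A // r) = card B"
proof -
  have "inj_on (\<lambda>x. r `` {x}) B"
    using assms by (intro inj_onI) (metis eq_equiv_class in_mono)
  moreover have "(\<lambda>x. r `` {x}) ` B = A // r"
    using assms(2,3) equiv_class_eq[OF assms(1)] by (fastforce simp: quotient_def)
  ultimately show ?thesis
    using card_image by force
qed

lemma rac_eq_card_mi_compositions: "rac n s = card (mi_compositions n s)"
  unfolding rac_def
  using equiv_flip_equiv mi_compositions_subset ex_flip_mirror_increasing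
    flip_equiv_mirror_increasing_eq
  by (rule card_quotient_representatives)

section \<open>The recurrence\<close>

lemma finite_compositions: "finite (compositions n s)"
proof (rule finite_subset)
  show "compositions n s \<subseteq> {xs. set xs \<subseteq> {..n} \<and> length xs = s}"
    by (auto simp: compositions_def member_le_sum_list)
qed (simp add: finite_lists_length_eq)

lemma mi_compositions_fibre:
  "{ys \<in> (\<Union>k. mi_compositions k s). sum_list ys = n} = mi_compositions n s"
  by (auto simp: mi_compositions_def compositions_def)

lemma rac_Suc_Suc:
  "rac n (Suc (Suc s)) = card (pair_extensions sum_list (\<Union>k. mi_compositions k s) n)"
proof -
  let ?f = "\<lambda>(a, b, ys). a # ys @ [b]"
  have "?f ` pair_extensions sum_list (\<Union>k. mi_compositions k s) n = mi_compositions n (Suc (Suc s))"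
  proof (intro equalityI subsetI)
    fix xs assume xs: "xs \<in> mi_compositions n (Suc (Suc s))"
    then obtain a zs where "xs = a # zs" "length zs = Suc s"
      by (auto simp: mi_compositions_def compositions_def length_Suc_conv)
    moreover then obtain ys b where "zs = ys @ [b]"
      by (cases zs rule: rev_cases) auto
    ultimately have aby: "xs = a # ys @ [b]" by simp
    then have "(a, b, ys) \<in> pair_extensions sum_list (\<Union>k. mi_compositions k s) n"
      using xs by (auto simp: pair_extensions_def mi_compositions_def compositions_def
          mirror_increasing_Cons_snoc)
    then show "xs \<in> ?f ` pair_extensions sum_list (\<Union>k. mi_compositions k s) n"
      by (force simp: aby)
  qed (auto simp: pair_extensions_def mi_compositions_def compositions_def
      mirror_increasing_Cons_snoc)
  moreover have "inj_on ?f X" for X :: "(nat \<times> nat \<times> nat list) set"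
    by (auto simp: inj_on_def)
  ultimately show ?thesis
    unfolding rac_eq_card_mi_compositions by (metis card_image)
qed

text \<open>The additive form avoids truncated subtraction: \<open>rac n (Suc (Suc s))\<close> on
  the left and \<open>rac n s\<close> on the right are the two parts of the term with factor q^2 -
  1.\<close>

lemma rac_recurrence:
  "rac (n + 3) (Suc (Suc s)) + rac n (Suc (Suc s)) =
    rac (n + 2) (Suc (Suc s)) + rac (n + 1) (Suc (Suc s)) + rac n s"
proof -
  have "finite {ys \<in> (\<Union>k. mi_compositions k s). sum_list ys = n}" for n
    unfolding mi_compositions_fibre using finite_compositions by (simp add: mi_compositions_def)
  from card_pair_extensions[OF this] show ?thesis
    unfolding rac_Suc_Suc mi_compositions_fibre rac_eq_card_mi_compositions[of n s] .
qed

text \<open>The smallest increasing pair, (1, 2), already has sum 3.\<close>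

lemma rac_Suc_Suc_eq_0: "n < 3 \<Longrightarrow> rac n (Suc (Suc s)) = 0"
  by (simp add: rac_Suc_Suc pair_extensions_empty)

lemma rac_0: "rac n 0 = of_bool (n = 0)"
proof -
  have "mi_compositions n 0 = (if n = 0 then {[]} else {})"
    by (auto simp: mi_compositions_def compositions_def mirror_increasing_def)
  then show ?thesis by (simp add: rac_eq_card_mi_compositions)
qed

lemma rac_1: "rac n (Suc 0) = of_bool (n \<noteq> 0)"
proof -
  have "mi_compositions n (Suc 0) = (if n = 0 then {} else {[n]})"
    by (auto simp: mi_compositions_def compositions_def mirror_increasing_def length_Suc_conv)
  then show ?thesis by (simp add: rac_eq_card_mi_compositions)
qed

lemma rac_zero: "rac 0 s = of_bool (s = 0)"
  \<comment> \<open>The nested split separates the lengths 0, 1 and at least 2.\<close>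
  by (cases s; cases "s - 1") (auto simp: rac_0 rac_1 rac_Suc_Suc_eq_0)

lemma rac_3: "rac 3 (Suc (Suc s)) = of_bool (s = 0)"
  using rac_recurrence[of 0 s] by (simp add: rac_Suc_Suc_eq_0 rac_zero)

theorem theorem4:
  fixes n s :: nat
  shows "coeff (phi n) s = int (rac n s)"
proof (induction n arbitrary: s rule: phi.induct)
  case 1
  show ?case
    by (simp add: rac_zero)
next
  case 2
  show ?case
    by (cases s; cases "s - 1") (auto simp: rac_0 rac_1 rac_Suc_Suc_eq_0)
next
  case 3
  show ?case
    by (cases s; cases "s - 1") (auto simp: rac_0 rac_1 rac_Suc_Suc_eq_0)
next
  case 4
  show ?case
    by (cases s; cases "s - 1")
      (auto simp: rac_0 rac_1 rac_3[unfolded numeral_3_eq_3] power2_eq_square coeff_pCons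
        split: nat.split)
next
  case (5 n)
  \<comment> \<open>Multiplication by q^2 shifts the coefficients by two places, matching the
    removal of one pair.\<close>
  have "[:0, 1:]\<^sup>2 * p = pCons 0 (pCons 0 p)" for p :: "int poly"
    by (simp add: power2_eq_square)
  then have phi: "coeff (phi (Suc (Suc (Suc (Suc n))))) s =
      int (rac (n + 3) s) + int (rac (n + 2) s) +
      (coeff (pCons 0 (pCons 0 (phi (Suc n)))) s - int (rac (n + 1) s))"
    using 5 by (simp add: left_diff_distrib numeral_3_eq_3)
  show ?case
  proof (cases s)
    case 0
    then show ?thesis unfolding phi by (simp add: rac_0)
  next
    case (Suc t)
    show ?thesis
    proof (cases t)
      \<comment> \<open>All sums involved are positive, so each \<open>rac\<close> is 1 and the
        claim reads 1 + 1 - 1 = 1. With a sum 0 this would fail, which is why \<open>phi 3\<close>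
        is a separate initial value.\<close>
      case 0
      then show ?thesis unfolding phi by (simp add: Suc rac_1)
    next
      case (Suc u)
      then show ?thesis
        unfolding phi using \<open>s = Suc t\<close> 5(3)[of u] rac_recurrence[of "Suc n" u]
        by (simp add: numeral_3_eq_3)
    qed
  qed
qed

end
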